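(* Let $n,N,J\ge 1$ be integers, let $Y\in\mathbb{R}^{n\times N}$, and let $\lambda, L$ be real numbers with $L>\lambda>0$. Let $(C^{0},D^{0})\in\mathbb{R}^{N\times J}\times\mathbb{R}^{n\times J}$ have columns $c_j^0$, $d_j^0$ satisfying $\|d_j^0\|_2=1$ and $\|c_j^0\|_\infty\le L$ for all $1\le j\le J$. Let $\{C^{t},D^{t}\}_{t\ge 0}$ be the bounded iterate sequence generated by the SOUP-DIL Algorithm with training data $Y$ and initial point $(C^{0},D^{0})$. Suppose each accumulation point $(C,D)$ of the iterate sequence is such that the matrix $B\in\mathbb{R}^{N\times J}$ with columns $b_j=E_j^Td_j$, where $E_j=Y-DC^T+d_jc_j^T$, $1\le j\le J$, has no entry with magnitude $\lambda$. Then every accumulation point of the iterate sequence is a critical point of the objective $f(C,D)$. Moreover, the two sequences with terms $\|D^t-D^{t-1}\|_F$ and $\|C^t-C^{t-1}\|_F$, respectively, both converge to zero as $t\to\infty$.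
   Context: Notation: for $C\in\mathbb{R}^{N\times J}$ and $D\in\mathbb{R}^{n\times J}$, $c_j$ and $d_j$ denote the $j$-th columns. $\|c\|_0$ is the number of non-zero entries of $c$. An accumulation point of a sequence is the limit of some subsequence. Objective: $$f(C,D)=\Big\|Y-\sum_{j=1}^{J}d_jc_j^{T}\Big\|_F^2+\lambda^2\sum_{j=1}^{J}\|c_j\|_0+\sum_{j=1}^{J}\chi(d_j)+\sum_{j=1}^{J}\psi(c_j),$$ where $\chi(d)=0$ if $\|d\|_2=1$ and $+\infty$ otherwise, and $\psi(c)=0$ if $\|c\|_\infty\le L$ and $+\infty$ otherwise. Hard thresholding: for $b\in\mathbb{R}^N$, $(H_\lambda(b))_i=0$ if $|b_i|<\lambda$ and $(H_\lambda(b))_i=b_i$ if $|b_i|\ge\lambda$. Below, $1_N$ is the all-ones vector of length $N$; $|\cdot|$, $\min$ and $\mathrm{sign}$ act entrywise on vectors; $\odot$ is the entrywise product; $v_1$ is the first column of the $n\times n$ identity matrix. SOUP-DIL Algorithm: given $(C^0,D^0)$, for $t=1,2,\dots$ and, within each $t$, for $j=1,\dots,J$ in order: put $C=[c_1^t,\dots,c_{j-1}^t,c_j^{t-1},\dots,c_J^{t-1}]$ and $D=[d_1^t,\dots,d_{j-1}^t,d_j^{t-1},\dots,d_J^{t-1}]$, then (i) sparse coding: $b^t=Y^Td_j^{t-1}-CD^Td_j^{t-1}+c_j^{t-1}$ and $c_j^t=\min(|H_\lambda(b^t)|,L1_N)\odot\mathrm{sign}(H_\lambda(b^t))$; (ii)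 dictionary atom update: $h^t=Yc_j^t-DC^Tc_j^t+d_j^{t-1}(c_j^{t-1})^Tc_j^t$, and $d_j^t=h^t/\|h^t\|_2$ if $c_j^t\ne0$, $d_j^t=v_1$ if $c_j^t=0$. Then $C^t=[c_1^t,\dots,c_J^t]$ and $D^t=[d_1^t,\dots,d_J^t]$. Critical points: for $g:\mathbb{R}^p\to(-\infty,+\infty]$ proper (i.e. $\mathrm{dom}\,g=\{x:g(x)<+\infty\}\ne\emptyset$) and $x\in\mathrm{dom}\,g$, the Fréchet sub-differential is $$\hat\partial g(x)=\Big\{h\in\mathbb{R}^p:\liminf_{b\to x,\,b\ne x}\tfrac{1}{\|b-x\|}\big(g(b)-g(x)-\langle b-x,h\rangle\big)\ge0\Big\},$$ and $\hat\partial g(x)=\emptyset$ if $x\notin\mathrm{dom}\,g$. The sub-differential is $\partial g(x)=\{\tilde h\in\mathbb{R}^p:\exists\,x_k\to x,\ g(x_k)\to g(x),\ h_k\in\hat\partial g(x_k),\ h_k\to\tilde h\}$. Norm and inner product are Euclidean (the space $\mathbb{R}^{N\times J}\times\mathbb{R}^{n\times J}$ of pairs $(C,D)$ is identified with $\mathbb{R}^{NJ+nJ}$). $x$ is a critical point of $g$ if $0\in\partial g(x)$. *)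

theory Defs
  imports "HOL-Analysis.Analysis"
begin

text \<open>
  An element of \<open>real ^ 'k ^ 'm\<close> is a matrix with rows indexed by \<open>'m\<close> and columns indexed by \<open>'k\<close>.
  The instance \<open>norm\<close> on this type is the Frobenius norm, and on pairs of matrices it
  is the Euclidean norm of the concatenated entries.  The linear order on the finite index
  type \<open>'J\<close> gives the order in which the columns are updated.
\<close>

subsection \<open>Critical points of extended-real-valued functions\<close>

definition edom :: "('a \<Rightarrow> ereal) \<Rightarrow> 'a set" where
  "edom g = {x. g x < \<infinity>}"

definition frechet_subdifferential :: "('a::euclidean_space \<Rightarrow> ereal) \<Rightarrow> 'a \<Rightarrow> 'a set" where
  "frechet_subdifferential g x =
     (if x \<in> edom g
      then {h. Liminf (at x)
                 (\<lambda>b. ereal (1 / norm (b - x)) * (g b - g x - ereal ((b - x) \<bullet> h))) \<ge> 0}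
      else {})"

definition subdifferential :: "('a::euclidean_space \<Rightarrow> ereal) \<Rightarrow> 'a \<Rightarrow> 'a set" where
  "subdifferential g x =
     {h'. \<exists>xs hs. xs \<longlonglongrightarrow> x \<and> (\<lambda>k. g (xs k)) \<longlonglongrightarrow> g x \<and>
            (\<forall>k::nat. hs k \<in> frechet_subdifferential g (xs k)) \<and> hs \<longlonglongrightarrow> h'}"

text \<open>The subdifferential is only meant for points of the domain, whence the first conjunct.\<close>

definition critical_point :: "('a::euclidean_space \<Rightarrow> ereal) \<Rightarrow> 'a \<Rightarrow> bool" where
  "critical_point g x \<longleftrightarrow> x \<in> edom g \<and> 0 \<in> subdifferential g x"

definition accumulation_point :: "(nat \<Rightarrow> 'a::topological_space) \<Rightarrow> 'a \<Rightarrow> bool" where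
  "accumulation_point X x \<longleftrightarrow> (\<exists>r. strict_mono r \<and> (X \<circ> r) \<longlonglongrightarrow> x)"

subsection \<open>The objective\<close>

definition outer :: "real ^ 'n \<Rightarrow> real ^ 'N \<Rightarrow> real ^ 'N ^ 'n" where
  "outer d c = (\<chi> i k. d $ i * c $ k)"

definition l0norm :: "real ^ 'N \<Rightarrow> nat" where
  "l0norm c = card {i. c $ i \<noteq> 0}"

definition chi_sphere :: "real ^ 'n \<Rightarrow> ereal" where
  "chi_sphere d = (if norm d = 1 then 0 else \<infinity>)"

definition psi_box :: "real \<Rightarrow> real ^ 'N \<Rightarrow> ereal" where
  "psi_box L c = (if infnorm c \<le> L then 0 else \<infinity>)"

definition soup_objective ::
  "real ^ 'N ^ 'n \<Rightarrow> real \<Rightarrow> real \<Rightarrow> (real ^ 'J ^ 'N) \<times> (real ^ 'J ^ 'n) \<Rightarrow> ereal" where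
  "soup_objective Y lam L = (\<lambda>(C, D).
     ereal ((norm (Y - (\<Sum>j\<in>UNIV. outer (column j D) (column j C))))\<^sup>2
            + lam\<^sup>2 * (\<Sum>j\<in>UNIV. real (l0norm (column j C))))
     + (\<Sum>j\<in>UNIV. chi_sphere (column j D))
     + (\<Sum>j\<in>UNIV. psi_box L (column j C)))"

subsection \<open>The SOUP-DIL algorithm\<close>

definition hard_threshold :: "real \<Rightarrow> real ^ 'N \<Rightarrow> real ^ 'N" where
  "hard_threshold lam b = (\<chi> i. if \<bar>b $ i\<bar> < lam then 0 else b $ i)"

definition clipped_threshold :: "real \<Rightarrow> real \<Rightarrow> real ^ 'N \<Rightarrow> real ^ 'N" where
  "clipped_threshold lam L b =
     (\<chi> i. min \<bar>hard_threshold lam b $ i\<bar> L * sgn (hard_threshold lam b $ i))"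

text \<open>\<open>mix_columns j A A'\<close> takes the columns before \<open>j\<close> from \<open>A\<close> and the others from \<open>A'\<close>.\<close>

definition mix_columns ::
  "'J::{finite,linorder} \<Rightarrow> real ^ 'J::{finite,linorder} ^ 'm \<Rightarrow>
   real ^ 'J::{finite,linorder} ^ 'm \<Rightarrow> real ^ 'J::{finite,linorder} ^ 'm" where
  "mix_columns j A A' = (\<chi> i k. if k < j then A $ i $ k else A' $ i $ k)"

definition sparse_code_arg ::
  "real ^ 'N ^ 'n \<Rightarrow> real ^ 'J ^ 'N \<Rightarrow> real ^ 'J ^ 'n \<Rightarrow> 'J \<Rightarrow> real ^ 'N" where
  "sparse_code_arg Y C D j =
     transpose Y *v column j D - (C ** transpose D) *v column j D + column j C"

definition atom_arg ::
  "real ^ 'N ^ 'n \<Rightarrow> real ^ 'J ^ 'N \<Rightarrow> real ^ 'J ^ 'n \<Rightarrow> 'J \<Rightarrow> real ^ 'N \<Rightarrow> real ^ 'n" where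
  "atom_arg Y C D j c =
     Y *v c - (D ** transpose C) *v c + (column j C \<bullet> c) *\<^sub>R column j D"

definition atom_update :: "real ^ 'N \<Rightarrow> real ^ 'n::{finite,linorder} \<Rightarrow> real ^ 'n::{finite,linorder}" where
  "atom_update c h = (if c \<noteq> 0 then (1 / norm h) *\<^sub>R h else axis (Min UNIV) 1)"

text \<open>
  The recursion below is well-founded along the lexicographic order on \<open>(t, j)\<close>, so it determines
  the sequences from the initial point.  In \<open>mix_columns j _ _\<close> column \<open>j\<close> is
  still the one of the previous outer iteration.
\<close>

definition soup_dil_iterates ::
  "real ^ 'N ^ 'n::{finite,linorder} \<Rightarrow> real \<Rightarrow> real \<Rightarrow>
   real ^ 'J::{finite,linorder} ^ 'N \<Rightarrow> real ^ 'J::{finite,linorder} ^ 'n::{finite,linorder} \<Rightarrow>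
   (nat \<Rightarrow> real ^ 'J::{finite,linorder} ^ 'N) \<Rightarrow>
   (nat \<Rightarrow> real ^ 'J::{finite,linorder} ^ 'n::{finite,linorder}) \<Rightarrow> bool" where
  "soup_dil_iterates Y lam L C0 D0 Cs Ds \<longleftrightarrow>
     Cs 0 = C0 \<and> Ds 0 = D0 \<and>
     (\<forall>t j. let C = mix_columns j (Cs (Suc t)) (Cs t);
                D = mix_columns j (Ds (Suc t)) (Ds t);
                c = column j (Cs (Suc t))
            in c = clipped_threshold lam L (sparse_code_arg Y C D j) \<and>
               column j (Ds (Suc t)) = atom_update c (atom_arg Y C D j c))"

subsection \<open>The matrix of sparse coding inputs at a point\<close>

definition residual_matrix ::
  "real ^ 'N ^ 'n \<Rightarrow> real ^ 'J ^ 'N \<Rightarrow> real ^ 'J ^ 'n \<Rightarrow> 'J \<Rightarrow> real ^ 'N ^ 'n" where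
  "residual_matrix Y C D j = Y - D ** transpose C + outer (column j D) (column j C)"

definition B_matrix ::
  "real ^ 'N ^ 'n \<Rightarrow> real ^ 'J ^ 'N \<Rightarrow> real ^ 'J ^ 'n \<Rightarrow> real ^ 'J ^ 'N" where
  "B_matrix Y C D = (\<chi> i j. (transpose (residual_matrix Y C D j) *v column j D) $ i)"

end

theory Submission
  imports Defs
begin

text \<open>
  With unit atoms, updating column \<open>j\<close> lowers the cost by the sum of two nonnegative gaps: the
  excess of the old code over the clipped threshold in the separable problem
  \<open>\<Sum>\<^sub>i (b\<^sub>i - c\<^sub>i)\<^sup>2 + lam\<^sup>2 [c\<^sub>i \<noteq> 0]\<close>, and \<open>2 h \<bullet> (d' - d)\<close> for the atom.  The cost
  is bounded below, so all gaps tend to \<open>0\<close>.  Along a subsequence converging to \<open>(C, D)\<close> both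
  block problems have a unique minimiser in the limit, hence by induction on \<open>j\<close> the next iterates
  converge to the same \<open>(C, D)\<close>, and compactness gives vanishing increments.  The limit is thus a
  fixed point, and there the objective exceeds its value by at least \<open>- K \<delta>\<^sup>2\<close> at distance
  \<open>\<delta>\<close>: the first-order term of an atom is parallel to \<open>d\<^sub>j\<close> and so of second order on the sphere,
  and that of a code entry is nonnegative on the box or dominated by the jump \<open>lam\<^sup>2\<close>.  Hence \<open>0\<close>
  lies in the Frechet subdifferential.
\<close>

subsection \<open>Scalar thresholding\<close>

text \<open>For 0 < lam < L this is a minimiser of \<open>entry_cost lam b\<close> on [-L, L]. In
  the tie |b| = lam, where 0 and b cost the same, the nonzero value is taken.\<close>

definition clip_thr :: "real \<Rightarrow> real \<Rightarrow> real \<Rightarrow> real" where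
  "clip_thr lam L b = (if \<bar>b\<bar> < lam then 0 else min \<bar>b\<bar> L * sgn b)"

text \<open>With a unit atom, completing the square decouples the objective in one code column into
  these terms, up to a constant.\<close>

definition entry_cost :: "real \<Rightarrow> real \<Rightarrow> real \<Rightarrow> real" where
  "entry_cost lam b c = (b - c)\<^sup>2 + lam\<^sup>2 * of_bool (c \<noteq> 0)"

lemma clipped_threshold_nth: "clipped_threshold lam L b $ i = clip_thr lam L (b $ i)"
  by (simp add: clipped_threshold_def hard_threshold_def clip_thr_def)

lemma abs_clip_thr_le: "0 < L \<Longrightarrow> \<bar>clip_thr lam L b\<bar> \<le> L"
  by (auto simp: clip_thr_def abs_mult sgn_if)

text \<open>Clipping happens at \<open>L > lam\<close>, so it cannot push a surviving entry below
  \<open>lam\<close>. This gap keeps the nonzero pattern stable under limits.\<close>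

lemma clip_thr_gap: "0 < lam \<Longrightarrow> lam < L \<Longrightarrow> clip_thr lam L b \<noteq> 0 \<Longrightarrow> lam \<le> \<bar>clip_thr lam L b\<bar>"
  by (auto simp: clip_thr_def abs_mult sgn_if split: if_splits)

text \<open>Thresholding keeps the sign of a surviving entry and never enlarges its magnitude.
  Summed over the entries, this makes the atom direction nonzero for a nonzero code.\<close>

lemma clip_thr_mult_ge: "0 < lam \<Longrightarrow> lam < L \<Longrightarrow> (clip_thr lam L b)\<^sup>2 \<le> clip_thr lam L b * b"
proof -
  assume a: "0 < lam" "lam < L"
  have "(min \<bar>b\<bar> L) * (min \<bar>b\<bar> L) \<le> (min \<bar>b\<bar> L) * (\<bar>b\<bar>)"
    using a by (intro mult_left_mono) auto
  then show ?thesis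
    using a by (auto simp: clip_thr_def sgn_if power2_eq_square abs_if split: if_splits)
qed

text \<open>By sign symmetry take b \<ge> 0. Below \<open>lam\<close>, the value 0 costs b^2, less
  than the jump. From \<open>lam\<close> on, nonzero candidates compete by their distance to b
  within the box, and 0 is compared separately. Only the tie |b| = lam spoils strictness.\<close>

lemma entry_cost_clip_thr_le:
  assumes "0 < lam" "lam < L" "\<bar>c\<bar> \<le> L"
  shows "entry_cost lam b (clip_thr lam L b) \<le> entry_cost lam b c"
    and "\<bar>b\<bar> \<noteq> lam \<Longrightarrow> c \<noteq> clip_thr lam L b \<Longrightarrow>
         entry_cost lam b (clip_thr lam L b) < entry_cost lam b c"
proof -
  have main: "entry_cost lam b (clip_thr lam L b) \<le> entry_cost lam b c \<and>
     (\<bar>b\<bar> \<noteq> lam \<longrightarrow> c \<noteq> clip_thr lam L b \<longrightarrow> entry_cost lam b (clip_thr lam L b) < entry_cost lam b c)"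
    if "0 \<le> b" "\<bar>c\<bar> \<le> L" for b c
  proof (cases "b < lam")
    case True
    then have "b\<^sup>2 < lam\<^sup>2" using that by (simp add: power_strict_mono)
    moreover have "0 \<le> (b - c)\<^sup>2" by simp
    ultimately have "b\<^sup>2 < (b - c)\<^sup>2 + lam\<^sup>2" by linarith
    then show ?thesis
      using True that by (auto simp: clip_thr_def entry_cost_def)
  next
    case False
    then have b: "lam \<le> b" "0 < b" using assms by auto
    have T: "clip_thr lam L b = min b L" using b by (simp add: clip_thr_def)
    have T0: "min b L \<noteq> 0" using b assms by auto
    show ?thesis
    proof (cases "c = 0")
      case True
      have "(b - min b L)\<^sup>2 + lam\<^sup>2 \<le> b\<^sup>2 \<and> (b \<noteq> lam \<longrightarrow> (b - min b L)\<^sup>2 + lam\<^sup>2 < b\<^sup>2)"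
      proof (cases "b \<le> L")
        case True
        have "lam\<^sup>2 \<le> b\<^sup>2" using b assms by (simp add: power_mono)
        moreover have "b \<noteq> lam \<Longrightarrow> lam\<^sup>2 < b\<^sup>2" using b assms by (simp add: power_strict_mono)
        ultimately show ?thesis using True by auto
      next
        case False
        \<comment> \<open>The decrease 2bL - L^2 - lam^2 is positive: b > L gives 2bL > 2L^2, and
          lam^2 < L^2.\<close>
        have 1: "lam\<^sup>2 < L\<^sup>2" using assms by (simp add: power_strict_mono)
        have 2: "L * L < b * L" using False assms by (intro mult_strict_right_mono) auto
        have "(b - L)\<^sup>2 + lam\<^sup>2 < b\<^sup>2"
          using 1 2 by (simp add: power2_eq_square algebra_simps)
        then show ?thesis using False by (auto simp: min_def)
      qed
      then show ?thesis using True b T T0 by (simp add: entry_cost_def)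
    next
      case False
      have "(b - min b L)\<^sup>2 \<le> (b - c)\<^sup>2 \<and> (c \<noteq> min b L \<longrightarrow> (b - min b L)\<^sup>2 < (b - c)\<^sup>2)"
      proof (cases "b \<le> L")
        case True
        then show ?thesis by auto
      next
        case False
        then have "b - L \<le> b - c" "0 \<le> b - L" "c \<noteq> L \<Longrightarrow> b - L < b - c"
          using that by auto
        then show ?thesis using False
          by (auto simp: min_def intro!: power_mono power_strict_mono)
      qed
      then show ?thesis using False b T T0 by (simp add: entry_cost_def)
    qed
  qed
  have neg: "clip_thr lam L (-b) = - clip_thr lam L b" for b
    by (simp add: clip_thr_def sgn_minus)
  have negc: "entry_cost lam (-b) (-c) = entry_cost lam b c" for b c
    by (simp add: entry_cost_def power2_eq_square algebra_simps)
  have all: "entry_cost lam b (clip_thr lam L b) \<le> entry_cost lam b c \<and>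
     (\<bar>b\<bar> \<noteq> lam \<longrightarrow> c \<noteq> clip_thr lam L b \<longrightarrow> entry_cost lam b (clip_thr lam L b) < entry_cost lam b c)"
  proof (cases "0 \<le> b")
    case True
    then show ?thesis using main[of b c] assms by auto
  next
    case False
    then show ?thesis using main[of "-b" "-c"] assms by (auto simp: neg negc)
  qed
  show "entry_cost lam b (clip_thr lam L b) \<le> entry_cost lam b c"
    using all by blast
  show "\<bar>b\<bar> \<noteq> lam \<Longrightarrow> c \<noteq> clip_thr lam L b \<Longrightarrow>
         entry_cost lam b (clip_thr lam L b) < entry_cost lam b c"
    using all by blast
qed

text \<open>A jump can occur only at |b| = lam; elsewhere the map agrees near b with 0 or with the
  clipping, which is continuous away from 0. This is where the assumption on \<open>B_matrix\<close>
  will enter.\<close>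

lemma tendsto_clip_thr:
  assumes "(f \<longlongrightarrow> b) F" "\<bar>b\<bar> \<noteq> lam" "0 < lam"
  shows "((\<lambda>x. clip_thr lam L (f x)) \<longlongrightarrow> clip_thr lam L b) F"
proof (cases "\<bar>b\<bar> < lam")
  case True
  have "\<forall>\<^sub>F x in F. \<bar>f x\<bar> < lam"
    using order_tendstoD(2)[OF tendsto_rabs[OF assms(1)] True] .
  then have "\<forall>\<^sub>F x in F. clip_thr lam L (f x) = 0"
    by eventually_elim (simp add: clip_thr_def)
  then show ?thesis using True by (simp add: clip_thr_def tendsto_eventually)
next
  case False
  then have b: "lam < \<bar>b\<bar>" "b \<noteq> 0" using assms by auto
  have "((\<lambda>x. min \<bar>f x\<bar> L * sgn (f x)) \<longlongrightarrow> min \<bar>b\<bar> L * sgn b) F"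
    by (intro tendsto_intros assms b)
  moreover have "\<forall>\<^sub>F x in F. min \<bar>f x\<bar> L * sgn (f x) = clip_thr lam L (f x)"
    using order_tendstoD(1)[OF tendsto_rabs[OF assms(1)] b(1)]
    by eventually_elim (simp add: clip_thr_def)
  ultimately show ?thesis using b
    by (simp add: clip_thr_def tendsto_cong)
qed

text \<open>The jump of the \<open>\<ell>\<^sub>0\<close> term is invisible along sequences whose entries avoid
  the punctured neighbourhood \<open>0 < \<bar>c\<bar> < lam\<close>.\<close>

lemma eventually_neq_0_iff_limit:
  fixes f :: "'a \<Rightarrow> real"
  assumes "(f \<longlongrightarrow> c) F" "0 < lam" "\<forall>\<^sub>F x in F. f x \<noteq> 0 \<longrightarrow> lam \<le> \<bar>f x\<bar>"
  shows "\<forall>\<^sub>F x in F. (f x \<noteq> 0) = (c \<noteq> 0)"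
proof (cases "c = 0")
  case True
  have "\<forall>\<^sub>F x in F. \<bar>f x\<bar> < lam"
    using order_tendstoD(2)[OF tendsto_rabs[OF assms(1)]] True assms by auto
  with assms(3) show ?thesis by eventually_elim (use True in auto)
next
  case False
  have "\<forall>\<^sub>F x in F. f x \<noteq> 0"
    using tendsto_imp_eventually_ne[OF assms(1) False] .
  then show ?thesis by eventually_elim (use False in auto)
qed

text \<open>The indicator of a nonzero entry is discontinuous at 0, but the gap hypothesis makes it
  eventually constant.\<close>

lemma tendsto_entry_cost:
  assumes "(f \<longlongrightarrow> c) F" "(g \<longlongrightarrow> b) F" "0 < lam" "\<forall>\<^sub>F x in F. f x \<noteq> 0 \<longrightarrow> lam \<le> \<bar>f x\<bar>"
  shows "((\<lambda>x. entry_cost lam (g x) (f x)) \<longlongrightarrow> entry_cost lam b c) F"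
proof -
  have "((\<lambda>x. of_bool (f x \<noteq> 0) :: real) \<longlongrightarrow> of_bool (c \<noteq> 0)) F"
    by (rule tendsto_eventually)
      (use eventually_neq_0_iff_limit[OF assms(1,3,4)] in eventually_elim, simp)
  then show ?thesis
    unfolding entry_cost_def by (intro tendsto_intros assms)
qed

text \<open>First-order optimality of a thresholded entry: the derivative of the quadratic term is
  \<open>-2 (b - c)\<close>, and a zero entry that becomes nonzero pays \<open>lam\<^sup>2\<close>.\<close>

lemma eventually_clip_thr_first_order:
  assumes "0 < lam" "lam < L" and c: "c = clip_thr lam L b"
  shows "\<forall>\<^sub>F c' in nhds c. \<bar>c'\<bar> \<le> L \<longrightarrow>
    0 \<le> - 2 * ((b - c) * (c' - c)) + lam\<^sup>2 * (of_bool (c' \<noteq> 0) - of_bool (c \<noteq> 0))"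
proof (cases "c = 0")
  case True
  have "((\<lambda>c'. 2 * \<bar>b * c'\<bar>) \<longlongrightarrow> 2 * \<bar>b * c\<bar>) (nhds c)"
    by (intro tendsto_intros filterlim_ident)
  then have "\<forall>\<^sub>F c' in nhds c. 2 * \<bar>b * c'\<bar> < lam\<^sup>2"
    using True assms by (intro order_tendstoD(2)) auto
  then show ?thesis by eventually_elim (use True in \<open>auto simp: abs_if split: if_splits\<close>)
next
  case False
  have "\<forall>\<^sub>F c' in nhds c. c' \<noteq> 0"
    using False by (simp add: t1_space_nhds)
  then show ?thesis
  proof eventually_elim
    case (elim c')
    \<comment> \<open>An unclipped nonzero entry equals b. A clipped one lies on the boundary of the
      box, where c' - c points inward and b - c outward.\<close>
    have "(b - c) * (c' - c) \<le> 0" if "\<bar>c'\<bar> \<le> L"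
    proof (cases "\<bar>b\<bar> \<le> L")
      case True
      then have "b = c" using c False by (auto simp: clip_thr_def sgn_if split: if_splits)
      then show ?thesis by simp
    next
      case big: False
      show ?thesis
      proof (cases "0 < b")
        case True
        then have "c = L" using c False big by (auto simp: clip_thr_def split: if_splits)
        then show ?thesis using True big that by (intro mult_nonneg_nonpos) auto
      next
        case False
        then have "c = - L" using c \<open>c \<noteq> 0\<close> big
          by (auto simp: clip_thr_def sgn_if split: if_splits)
        then show ?thesis using False big that by (intro mult_nonpos_nonneg) auto
      qed
    qed
    then show ?case using elim False by auto
  qed
qed

subsection \<open>Matrices as sums of outer products\<close>

lemma column_diff: "column j (A - B) = column j A - column j (B :: real ^ 'k ^ 'm)"
  by (simp add: vec_eq_iff column_def)

lemma column_nth: "column j A $ i = A $ i $ j"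
  by (simp add: column_def)

lemma norm_column_le: "norm (column j A) \<le> norm (A :: real ^ 'k ^ 'm)"
proof -
  have "(norm (column j A))\<^sup>2 = (\<Sum>i\<in>UNIV. (A $ i $ j)\<^sup>2)"
    by (simp add: norm_vec_def L2_set_def sum_nonneg column_nth)
  also have "\<dots> \<le> (\<Sum>i\<in>UNIV. (norm (A $ i))\<^sup>2)"
  proof (intro sum_mono)
    fix i
    show "(A $ i $ j)\<^sup>2 \<le> (norm (A $ i))\<^sup>2"
      using power_mono[OF Finite_Cartesian_Product.norm_nth_le[of "A $ i" j], of 2] by simp
  qed
  also have "\<dots> = (norm A)\<^sup>2"
    by (simp add: norm_vec_def L2_set_def sum_nonneg)
  finally show ?thesis by (rule power2_le_imp_le) simp
qed

lemma inner_outer: "R \<bullet> outer d c = d \<bullet> (R *v c)"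
  by (simp add: inner_vec_def outer_def matrix_vector_mult_def sum_distrib_left mult_ac)

lemma inner_outer': "R \<bullet> outer d c = (transpose R *v d) \<bullet> c"
  by (simp add: inner_outer dot_lmul_matrix)

lemma power2_norm_diff: "(norm (x - y))\<^sup>2 = (norm x)\<^sup>2 - 2 * (x \<bullet> y) + (norm (y :: 'a::real_inner))\<^sup>2"
  by (simp add: power2_norm_eq_inner inner_diff_left inner_diff_right inner_commute)

lemma norm_outer: "norm (outer d c) = norm d * norm c"
proof -
  have "outer d c \<bullet> outer d c = (d \<bullet> d) * (c \<bullet> c)"
    by (simp add: inner_vec_def outer_def sum_distrib_left sum_distrib_right mult_ac
        sum_product)
  then show ?thesis
    by (simp add: norm_eq_sqrt_inner real_sqrt_mult)
qed

lemma matrix_mult_transpose_outer: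
  fixes D :: "real ^ 'J ^ 'n" and C :: "real ^ 'J ^ 'N"
  shows "D ** transpose C = (\<Sum>j\<in>UNIV. outer (column j D) (column j C))"
  by (simp add: vec_eq_iff outer_def matrix_matrix_mult_def transpose_def column_def)

lemma outer_mult_vec: "outer d c *v x = (c \<bullet> x) *\<^sub>R d"
  by (simp add: vec_eq_iff outer_def matrix_vector_mult_def inner_vec_def sum_distrib_left
      sum_distrib_right mult_ac)

lemma outer_diff_right: "outer d (c - c') = outer d c - outer d c'"
  by (simp add: vec_eq_iff outer_def algebra_simps)

lemma outer_diff_left: "outer (d - d') c = outer d c - outer d' c"
  by (simp add: vec_eq_iff outer_def algebra_simps)

lemma vector_matrix_mult_diff: "x v* (A - B) = x v* A - x v* (B :: real ^ 'm ^ 'k)"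
  by (simp add: vec_eq_iff vector_matrix_mult_def algebra_simps sum_subtractf)

lemma vector_matrix_mult_add: "x v* (A + B) = x v* A + x v* (B :: real ^ 'm ^ 'k)"
  by (simp add: vec_eq_iff vector_matrix_mult_def algebra_simps sum.distrib)

lemma vector_matrix_mult_outer: "x v* outer d c = (x \<bullet> d) *\<^sub>R c"
  by (simp add: vec_eq_iff vector_matrix_mult_def outer_def inner_vec_def sum_distrib_left sum_distrib_right
      mult_ac)

text \<open>With R = Y - D C^T this reads b - c = R^T d, which is minus half the gradient of the
  squared residual norm in column j of C.\<close>

lemma sparse_code_arg_residual:
  "sparse_code_arg Y C D j = transpose (Y - D ** transpose C) *v column j D + column j C"
proof -
  have "C ** transpose D *v column j D = column j D v* (D ** transpose C)"
    by (simp add: matrix_transpose_mul flip: transpose_matrix_vector)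
  then show ?thesis
    by (simp add: sparse_code_arg_def vector_matrix_mult_diff)
qed

lemma atom_arg_residual:
  "atom_arg Y C D j c = (Y - D ** transpose C) *v c + (column j C \<bullet> c) *\<^sub>R column j D"
  by (simp add: atom_arg_def matrix_vector_mult_diff_rdistrib)

text \<open>Both sides equal d . (R c) + c_j . c with R the residual; the unit norm removes a factor
  d . d. Positivity of c . b thus passes to h . d.\<close>

lemma inner_atom_arg:
  assumes "norm (column j D) = 1"
  shows "atom_arg Y C D j c \<bullet> column j D = c \<bullet> sparse_code_arg Y C D j"
proof -
  have "column j D \<bullet> column j D = 1" using assms by (simp add: norm_eq_1)
  moreover have "(R *v c) \<bullet> d = c \<bullet> (transpose R *v d)" for R d
    by (metis dot_lmul_matrix inner_commute transpose_matrix_vector)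
  ultimately show ?thesis
    by (simp add: atom_arg_residual sparse_code_arg_residual inner_add_left inner_add_right
        inner_commute[of c "column j C"] del: transpose_matrix_vector)
qed

text \<open>Adding the outer product of column j back to the residual contributes (d . d) c_j = c_j,
  so the assumption on \<open>B_matrix\<close> speaks of the threshold inputs.\<close>

lemma B_matrix_nth:
  assumes "norm (column j D) = 1"
  shows "B_matrix Y C D $ i $ j = sparse_code_arg Y C D j $ i"
proof -
  have "column j D \<bullet> column j D = 1" using assms by (simp add: norm_eq_1)
  then show ?thesis
    by (simp add: B_matrix_def residual_matrix_def sparse_code_arg_residual
        vector_matrix_mult_add vector_matrix_mult_outer)
qed

text \<open>The product is a sum of outer products of columns, and only summand j changes.\<close>

lemma matrix_mult_transpose_update_right:
  fixes D :: "real ^ 'J ^ 'n" and C C' :: "real ^ 'J ^ 'N"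
  assumes "\<And>k. k \<noteq> j \<Longrightarrow> column k C' = column k C"
  shows "D ** transpose C' = D ** transpose C + outer (column j D) (column j C' - column j C)"
proof -
  have "D ** transpose C' - D ** transpose C =
      (\<Sum>k\<in>UNIV. outer (column k D) (column k C' - column k C))"
    by (simp add: matrix_mult_transpose_outer outer_diff_right sum_subtractf)
  also have "\<dots> = (\<Sum>k\<in>{j}. outer (column k D) (column k C' - column k C))"
    by (rule sum.mono_neutral_right) (auto simp: assms vec_eq_iff outer_def)
  finally show ?thesis by (simp add: algebra_simps)
qed

lemma matrix_mult_transpose_update_left:
  fixes D D' :: "real ^ 'J ^ 'n" and C :: "real ^ 'J ^ 'N"
  assumes "\<And>k. k \<noteq> j \<Longrightarrow> column k D' = column k D"
  shows "D' ** transpose C = D ** transpose C + outer (column j D' - column j D) (column j C)"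
proof -
  have "D' ** transpose C - D ** transpose C =
      (\<Sum>k\<in>UNIV. outer (column k D' - column k D) (column k C))"
    by (simp add: matrix_mult_transpose_outer outer_diff_left sum_subtractf)
  also have "\<dots> = (\<Sum>k\<in>{j}. outer (column k D' - column k D) (column k C))"
    by (rule sum.mono_neutral_right) (auto simp: assms vec_eq_iff outer_def)
  finally show ?thesis by (simp add: algebra_simps)
qed

subsection \<open>The finite part of the objective\<close>

text \<open>Nonzeros are counted by a sum of indicators so that changes can be computed entry by
  entry.\<close>

definition soup_cost :: "real ^ 'N ^ 'n \<Rightarrow> real \<Rightarrow> real ^ 'J ^ 'N \<Rightarrow> real ^ 'J ^ 'n \<Rightarrow> real" where
  "soup_cost Y lam C D = (norm (Y - D ** transpose C))\<^sup>2
     + lam\<^sup>2 * (\<Sum>j\<in>UNIV. \<Sum>i\<in>UNIV. of_bool (C $ i $ j \<noteq> 0))"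

lemma soup_cost_nonneg: "0 \<le> soup_cost Y lam C D"
  by (simp add: soup_cost_def sum_nonneg)

lemma infnorm_le_iff: "infnorm (c :: real ^ 'k) \<le> L \<longleftrightarrow> (\<forall>i. \<bar>c $ i\<bar> \<le> L)"
proof
  show "infnorm c \<le> L \<Longrightarrow> \<forall>i. \<bar>c $ i\<bar> \<le> L"
    using component_le_infnorm_cart order_trans by blast
  show "\<forall>i. \<bar>c $ i\<bar> \<le> L \<Longrightarrow> infnorm c \<le> L"
    unfolding infnorm_cart by (rule cSup_least) auto
qed

lemma soup_objective_eq:
  "soup_objective Y lam L (C, D) =
     (if (\<forall>j. norm (column j D) = 1) \<and> (\<forall>i j. \<bar>C $ i $ j\<bar> \<le> L)
      then ereal (soup_cost Y lam C D) else \<infinity>)"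
proof -
  have l0: "(\<Sum>j\<in>UNIV. real (l0norm (column j C)))
      = (\<Sum>j\<in>UNIV. \<Sum>i\<in>UNIV. of_bool (C $ i $ j \<noteq> 0))"
    by (simp add: l0norm_def column_nth)
  have chi: "(\<Sum>j\<in>UNIV. chi_sphere (column j D)) =
      (if \<forall>j. norm (column j D) = 1 then 0 else \<infinity>)"
    by (auto simp: chi_sphere_def sum_Pinfty)
  have psi: "(\<Sum>j\<in>UNIV. psi_box L (column j C)) =
      (if \<forall>i j. \<bar>C $ i $ j\<bar> \<le> L then 0 else \<infinity>)"
    by (auto simp: psi_box_def sum_Pinfty infnorm_le_iff column_nth)
  show ?thesis
    unfolding soup_objective_def prod.case l0 chi psi
    by (simp add: soup_cost_def matrix_mult_transpose_outer)
qed

text \<open>The new code adds d (c' - c)^T to the product. Since |d| = 1, completing the square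
  turns the change of the squared residual norm into |b - c'|^2 - |b - c|^2.\<close>

lemma soup_cost_code_step:
  assumes agree: "\<And>k. k \<noteq> j \<Longrightarrow> column k C' = column k C" and d: "norm (column j D) = 1"
  shows "soup_cost Y lam C D - soup_cost Y lam C' D =
    (\<Sum>i\<in>UNIV. entry_cost lam (sparse_code_arg Y C D j $ i) (C $ i $ j)
             - entry_cost lam (sparse_code_arg Y C D j $ i) (C' $ i $ j))"
proof -
  define R where "R = Y - D ** transpose C"
  define b where "b = sparse_code_arg Y C D j"
  define c where "c = column j C"
  define c' where "c' = column j C'"
  have b: "transpose R *v column j D = b - c"
    by (simp add: b_def c_def R_def sparse_code_arg_residual)
  have "Y - D ** transpose C' = R - outer (column j D) (c' - c)"
    by (subst matrix_mult_transpose_update_right[of j C' C D]) (auto simp: agree R_def c_def c'_def)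
  then have "(norm (Y - D ** transpose C'))\<^sup>2 =
      (norm R)\<^sup>2 - 2 * ((b - c) \<bullet> (c' - c)) + (norm (c' - c))\<^sup>2"
    by (simp only: power2_norm_diff inner_outer' b norm_outer d mult_1)
  also have "\<dots> = (norm R)\<^sup>2 + (norm (b - c'))\<^sup>2 - (norm (b - c))\<^sup>2"
    unfolding power2_norm_eq_inner by (simp add: algebra_simps inner_commute)
  finally have 1: "(norm R)\<^sup>2 - (norm (Y - D ** transpose C'))\<^sup>2 =
      (\<Sum>i\<in>UNIV. (b $ i - C $ i $ j)\<^sup>2 - (b $ i - C' $ i $ j)\<^sup>2)"
    by (simp add: norm_vec_def[of "b - _"] L2_set_def sum_nonneg sum_subtractf
        c_def c'_def column_nth)
  \<comment> \<open>Only column j contributes to the change of the nonzero count.\<close>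
  have "(\<Sum>k\<in>UNIV. \<Sum>i\<in>UNIV. of_bool (C $ i $ k \<noteq> 0) - of_bool (C' $ i $ k \<noteq> 0)) =
    (\<Sum>k\<in>{j}. \<Sum>i\<in>UNIV. of_bool (C $ i $ k \<noteq> 0) - of_bool (C' $ i $ k \<noteq> 0) :: real)"
  proof (rule sum.mono_neutral_right)
    show "\<forall>k\<in>UNIV - {j}. (\<Sum>i\<in>UNIV. of_bool (C $ i $ k \<noteq> 0) - of_bool (C' $ i $ k \<noteq> 0) :: real) = 0"
      using agree by (simp add: column_def vec_eq_iff)
  qed auto
  then have 2: "(\<Sum>k\<in>UNIV. \<Sum>i\<in>UNIV. of_bool (C $ i $ k \<noteq> 0)) -
    (\<Sum>k\<in>UNIV. \<Sum>i\<in>UNIV. of_bool (C' $ i $ k \<noteq> 0)) =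
    (\<Sum>i\<in>UNIV. of_bool (C $ i $ j \<noteq> 0) - of_bool (C' $ i $ j \<noteq> 0) :: real)"
    by (simp only: sum_subtractf) simp
  have "soup_cost Y lam C D - soup_cost Y lam C' D =
     ((norm R)\<^sup>2 - (norm (Y - D ** transpose C'))\<^sup>2) +
     lam\<^sup>2 * ((\<Sum>k\<in>UNIV. \<Sum>i\<in>UNIV. of_bool (C $ i $ k \<noteq> 0)) -
       (\<Sum>k\<in>UNIV. \<Sum>i\<in>UNIV. of_bool (C' $ i $ k \<noteq> 0)))"
    unfolding soup_cost_def R_def by (simp only: algebra_simps)
  also have "\<dots> = (\<Sum>i\<in>UNIV. entry_cost lam (b $ i) (C $ i $ j) - entry_cost lam (b $ i) (C' $ i $ j))"
    unfolding 1 2 sum_distrib_left sum.distrib[symmetric]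
    by (intro sum.cong refl) (simp add: entry_cost_def algebra_simps)
  finally show ?thesis by (simp add: b_def)
qed

text \<open>For unit atoms |d' - d|^2 = -2 d . (d' - d), so the cost is affine in the new atom with
  slope -2h. The direction h is formed from \<open>C\<close>, which still has the old column
  j.\<close>

lemma soup_cost_atom_step:
  assumes agreeC: "\<And>k. k \<noteq> j \<Longrightarrow> column k C' = column k C"
    and agreeD: "\<And>k. k \<noteq> j \<Longrightarrow> column k D' = column k D"
    and d: "norm (column j D) = 1" "norm (column j D') = 1"
  shows "soup_cost Y lam C' D - soup_cost Y lam C' D' =
    2 * (atom_arg Y C D j (column j C') \<bullet> (column j D' - column j D))"
proof -
  define R where "R = Y - D ** transpose C'"
  define c where "c = column j C'"
  define d where "d = column j D"
  define d' where "d' = column j D'"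
  have dd: "d \<bullet> d = 1" "d' \<bullet> d' = 1"
    using assms(3,4) by (simp_all add: d_def d'_def norm_eq_1)
  have "Y - D ** transpose C = R + outer d (c - column j C)"
    unfolding R_def
    by (subst matrix_mult_transpose_update_right[of j C' C D]) (auto simp: agreeC c_def d_def)
  \<comment> \<open>The old code column cancels: in terms of the residual R of the new code, h is R
    c + |c|^2 d.\<close>
  then have h: "atom_arg Y C D j c = R *v c + (c \<bullet> c) *\<^sub>R d"
    by (simp add: atom_arg_residual matrix_vector_mult_add_rdistrib outer_mult_vec inner_diff_left
        d_def scaleR_left_diff_distrib)
  have "Y - D' ** transpose C' = R - outer (d' - d) c"
    by (subst matrix_mult_transpose_update_left[of j D' D C'])
      (auto simp: agreeD R_def c_def d_def d'_def)
  then have "(norm (Y - D' ** transpose C'))\<^sup>2 =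
      (norm R)\<^sup>2 - 2 * ((R *v c) \<bullet> (d' - d)) + (norm (d' - d))\<^sup>2 * (c \<bullet> c)"
    by (simp only: power2_norm_diff inner_outer norm_outer power_mult_distrib
        power2_norm_eq_inner[of c] inner_commute)
  also have "\<dots> = (norm R)\<^sup>2 - 2 * ((R *v c + (c \<bullet> c) *\<^sub>R d) \<bullet> (d' - d))"
    unfolding power2_norm_eq_inner
    by (simp add: algebra_simps inner_commute dd)
  finally show ?thesis
    unfolding h[symmetric] by (simp add: soup_cost_def R_def c_def d_def d'_def)
qed

subsection \<open>Critical points\<close>

text \<open>The difference quotient is at least -K |y - x|, which tends to 0.\<close>

lemma zero_in_frechet_subdifferential:
  fixes x :: "'a::euclidean_space"
  assumes x: "g x = ereal v"
    and bound: "\<forall>\<^sub>F y in at x. ereal (v - K * (norm (y - x))\<^sup>2) \<le> g y"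
  shows "0 \<in> frechet_subdifferential g x"
proof -
  have "((\<lambda>y. ereal (- (K * norm (y - x)))) \<longlongrightarrow> ereal (- (K * norm (x - x)))) (at x)"
    by (intro tendsto_intros)
  then have lim: "Liminf (at x) (\<lambda>y. ereal (- (K * norm (y - x)))) = 0"
    by (intro lim_imp_Liminf) (auto simp: zero_ereal_def)
  have "\<forall>\<^sub>F y in at x. ereal (- (K * norm (y - x))) \<le>
      ereal (1 / norm (y - x)) * (g y - g x - ereal ((y - x) \<bullet> 0))"
    using bound eventually_neq_at_within[of x]
  proof eventually_elim
    case (elim y)
    then have pos: "0 < norm (y - x)" by simp
    show ?case
    proof (cases "g y")
      case (real w)
      then have "- (K * (norm (y - x))\<^sup>2) \<le> w - v" using elim by simp
      then have "- (K * norm (y - x)) \<le> (w - v) / norm (y - x)"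
        using pos by (simp add: pos_le_divide_eq power2_eq_square mult_ac)
      then show ?thesis using real x by simp
    qed (use elim pos x in auto)
  qed
  from Liminf_mono[OF this] show ?thesis
    unfolding lim frechet_subdifferential_def edom_def by (simp add: x)
qed

text \<open>The change of D C^T splits into code, atom and mixed parts. \<open>entry\<close> handles
  the first together with the nonzero count, \<open>par\<close> and the unit norms make the second
  quadratic, Cauchy-Schwarz bounds the third, and the squared norm of the whole change is
  dropped.\<close>

lemma soup_cost_lower_bound:
  fixes C :: "real ^ 'J ^ 'N" and D :: "real ^ 'J ^ 'n"
  assumes unit: "\<And>j. norm (column j D) = 1" "\<And>j. norm (column j D') = 1"
    and entry: "\<And>i j. 0 \<le> - 2 * ((sparse_code_arg Y C D j $ i - C $ i $ j) * (C' $ i $ j - C $ i $ j))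
            + lam\<^sup>2 * (of_bool (C' $ i $ j \<noteq> 0) - of_bool (C $ i $ j \<noteq> 0))"
    and par: "\<And>j. (Y - D ** transpose C) *v column j C = s j *\<^sub>R column j D"
  shows "soup_cost Y lam C D - (\<Sum>j\<in>UNIV. \<bar>s j\<bar> + 2 * norm (Y - D ** transpose C)) *
     (norm ((C', D') - (C, D)))\<^sup>2 \<le> soup_cost Y lam C' D'"
proof -
  define R where "R = Y - D ** transpose C"
  define X where "X = C' - C"
  define Z where "Z = D' - D"
  define m where "m = norm ((C', D') - (C, D))"
  define S where "S = D ** transpose X + Z ** transpose C + Z ** transpose X"
  have Xm: "norm X \<le> m" and Zm: "norm Z \<le> m"
    using norm_fst_le[of X Z] norm_snd_le[of Z X] by (simp_all add: m_def X_def Z_def)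
  have S: "S = D' ** transpose C' - D ** transpose C"
    by (simp add: S_def X_def Z_def matrix_mult_transpose_outer column_diff outer_diff_left
        outer_diff_right sum_subtractf)
  have RS: "Y - D' ** transpose C' = R - S"
    by (simp add: S R_def)
  define l where "l i j = lam\<^sup>2 * (of_bool (C' $ i $ j \<noteq> 0) - of_bool (C $ i $ j \<noteq> 0))" for i j
  have "R \<bullet> S = (\<Sum>j\<in>UNIV. (transpose R *v column j D) \<bullet> column j X)
      + (\<Sum>j\<in>UNIV. column j Z \<bullet> (R *v column j C))
      + (\<Sum>j\<in>UNIV. R \<bullet> outer (column j Z) (column j X))"
    unfolding S_def inner_add_right matrix_mult_transpose_outer inner_sum_right
    by (simp only: inner_outer' inner_outer[symmetric])
  then have RS2: "- 2 * (R \<bullet> S) + (\<Sum>j\<in>UNIV. \<Sum>i\<in>UNIV. l i j) =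
     (\<Sum>j\<in>UNIV. (- 2 * ((transpose R *v column j D) \<bullet> column j X) + (\<Sum>i\<in>UNIV. l i j))
        + (- 2 * (column j Z \<bullet> (R *v column j C)))
        + (- 2 * (R \<bullet> outer (column j Z) (column j X))))"
    by (simp add: sum.distrib sum_distrib_left sum_subtractf sum_negf algebra_simps)
  have "- ((\<bar>s j\<bar> + 2 * norm R) * m\<^sup>2) \<le>
        (- 2 * ((transpose R *v column j D) \<bullet> column j X) + (\<Sum>i\<in>UNIV. l i j))
        + (- 2 * (column j Z \<bullet> (R *v column j C)))
        + (- 2 * (R \<bullet> outer (column j Z) (column j X)))" for j
  proof -
    have zm: "norm (column j Z) \<le> m" and xm: "norm (column j X) \<le> m"
      using norm_column_le order_trans Xm Zm by blast+
    have "transpose R *v column j D = sparse_code_arg Y C D j - column j C"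
      by (simp add: R_def sparse_code_arg_residual)
    then have "- 2 * ((transpose R *v column j D) \<bullet> column j X) + (\<Sum>i\<in>UNIV. l i j) =
      (\<Sum>i\<in>UNIV. - 2 * ((sparse_code_arg Y C D j $ i - C $ i $ j) * (C' $ i $ j - C $ i $ j)) + l i j)"
      by (simp add: inner_vec_def sum.distrib sum_subtractf sum_distrib_left X_def column_nth sum_negf)
    also have "\<dots> \<ge> 0" unfolding l_def by (intro sum_nonneg entry)
    finally have 1: "0 \<le> - 2 * ((transpose R *v column j D) \<bullet> column j X) + (\<Sum>i\<in>UNIV. l i j)" .
    have D': "column j D' = column j D + column j Z"
      by (simp add: Z_def column_diff)
    \<comment> \<open>Both atoms are unit, so the component of \<open>column j Z\<close> along
      \<open>column j D\<close> is of second order.\<close>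
    have "(norm (column j D'))\<^sup>2 = (norm (column j D))\<^sup>2 + 2 * (column j Z \<bullet> column j D) + (norm (column j Z))\<^sup>2"
      unfolding D' power2_norm_eq_inner by (simp add: algebra_simps inner_commute)
    then have "- 2 * (column j Z \<bullet> column j D) = (norm (column j Z))\<^sup>2"
      using unit by simp
    moreover have "- 2 * (column j Z \<bullet> (R *v column j C)) = s j * (- 2 * (column j Z \<bullet> column j D))"
      using par[of j] by (simp add: R_def)
    ultimately have "- 2 * (column j Z \<bullet> (R *v column j C)) = s j * (norm (column j Z))\<^sup>2"
      by simp
    \<comment> \<open>The multiplier \<open>s j\<close> may have either sign, hence the passage
      through its absolute value.\<close>
    moreover have "- \<bar>s j\<bar> * m\<^sup>2 \<le> - \<bar>s j\<bar> * (norm (column j Z))\<^sup>2"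
      using zm by (intro mult_left_mono_neg power_mono) auto
    moreover have "- \<bar>s j\<bar> * (norm (column j Z))\<^sup>2 \<le> s j * (norm (column j Z))\<^sup>2"
      by (intro mult_right_mono) auto
    ultimately have 2: "- \<bar>s j\<bar> * m\<^sup>2 \<le> - 2 * (column j Z \<bullet> (R *v column j C))"
      by simp
    have "R \<bullet> outer (column j Z) (column j X) \<le> norm R * (norm (column j Z) * norm (column j X))"
      using norm_cauchy_schwarz[of R "outer (column j Z) (column j X)"] by (simp add: norm_outer)
    also have "\<dots> \<le> norm R * (m * m)"
      using zm xm by (intro mult_left_mono mult_mono) (auto intro: order_trans[OF norm_ge_zero])
    finally have 3: "- 2 * (norm R * m\<^sup>2) \<le> - 2 * (R \<bullet> outer (column j Z) (column j X))"
      by (simp add: power2_eq_square)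
    from 1 2 3 show ?thesis by (simp add: algebra_simps)
  qed
  then have "(\<Sum>j\<in>UNIV. - ((\<bar>s j\<bar> + 2 * norm R) * m\<^sup>2)) \<le> - 2 * (R \<bullet> S) + (\<Sum>j\<in>UNIV. \<Sum>i\<in>UNIV. l i j)"
    unfolding RS2 by (intro sum_mono)
  moreover have "(\<Sum>j\<in>UNIV. - ((\<bar>s j\<bar> + 2 * norm R) * m\<^sup>2)) = - ((\<Sum>j\<in>UNIV. \<bar>s j\<bar> + 2 * norm R) * m\<^sup>2)"
    by (simp only: sum_negf sum_distrib_right)
  moreover have "(norm R)\<^sup>2 - 2 * (R \<bullet> S) \<le> (norm (Y - D' ** transpose C'))\<^sup>2"
    unfolding RS power2_norm_eq_inner by (simp add: inner_diff_left inner_diff_right inner_commute)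
  moreover have "(\<Sum>j\<in>UNIV. \<Sum>i\<in>UNIV. l i j) =
      lam\<^sup>2 * (\<Sum>j\<in>UNIV. \<Sum>i\<in>UNIV. of_bool (C' $ i $ j \<noteq> 0)) - lam\<^sup>2 * (\<Sum>j\<in>UNIV. \<Sum>i\<in>UNIV. of_bool (C $ i $ j \<noteq> 0))"
    unfolding l_def
    by (simp only: sum_distrib_left[symmetric] sum_subtractf right_diff_distrib)
  ultimately show ?thesis
    unfolding soup_cost_def R_def[symmetric] m_def[symmetric] by linarith
qed

text \<open>\<open>code\<close> and \<open>par\<close> are the stationarity conditions of the two
  updates. They yield a local quadratic lower bound on the domain; off the domain the objective is
  infinite.\<close>

lemma critical_point_soup_objective:
  fixes C :: "real ^ 'J ^ 'N" and D :: "real ^ 'J ^ 'n"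
  assumes lam: "0 < lam" "lam < L"
    and unit: "\<And>j. norm (column j D) = 1"
    and code: "\<And>i j. C $ i $ j = clip_thr lam L (sparse_code_arg Y C D j $ i)"
    and par: "\<And>j. \<exists>s. (Y - D ** transpose C) *v column j C = s *\<^sub>R column j D"
  shows "critical_point (soup_objective Y lam L) (C, D)"
proof -
  obtain s where s: "\<And>j. (Y - D ** transpose C) *v column j C = s j *\<^sub>R column j D"
    using par by metis
  define K where "K = (\<Sum>j\<in>UNIV. \<bar>s j\<bar> + 2 * norm (Y - D ** transpose C))"
  have "\<bar>C $ i $ j\<bar> \<le> L" for i j
    unfolding code[of i j] using lam by (intro abs_clip_thr_le) auto
  then have dom: "soup_objective Y lam L (C, D) = ereal (soup_cost Y lam C D)"
    using unit by (simp add: soup_objective_eq)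
  define P where "P i j c' \<longleftrightarrow> (\<bar>c'\<bar> \<le> L \<longrightarrow>
      0 \<le> - 2 * ((sparse_code_arg Y C D j $ i - C $ i $ j) * (c' - C $ i $ j))
        + lam\<^sup>2 * (of_bool (c' \<noteq> 0) - of_bool (C $ i $ j \<noteq> 0)))" for i j c'
  have "\<forall>\<^sub>F z in at (C, D). P i j (fst z $ i $ j)" for i j
  proof -
    have "((\<lambda>z. fst z $ i $ j) \<longlongrightarrow> fst (C, D) $ i $ j) (at (C, D))"
      by (intro tendsto_intros)
    then show ?thesis
      using eventually_clip_thr_first_order[OF lam code[of i j], folded P_def]
      by (simp add: filterlim_iff)
  qed
  then have "\<forall>\<^sub>F z in at (C, D). \<forall>i j. P i j (fst z $ i $ j)"
    by (simp add: eventually_all_finite)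
  then have "\<forall>\<^sub>F z in at (C, D).
      ereal (soup_cost Y lam C D - K * (norm (z - (C, D)))\<^sup>2) \<le> soup_objective Y lam L z"
  proof eventually_elim
    case (elim z)
    obtain C' D' where z: "z = (C', D')" by (cases z)
    show ?case
    proof (cases "(\<forall>j. norm (column j D') = 1) \<and> (\<forall>i j. \<bar>C' $ i $ j\<bar> \<le> L)")
      case True
      then have "soup_cost Y lam C D - K * (norm ((C', D') - (C, D)))\<^sup>2 \<le> soup_cost Y lam C' D'"
        unfolding K_def using elim unfolding z P_def
        by (intro soup_cost_lower_bound unit s) auto
      then show ?thesis using True by (simp add: z soup_objective_eq)
    next
      case False
      then show ?thesis by (simp only: z soup_objective_eq if_False) simp
    qed
  qed
  from zero_in_frechet_subdifferential[OF dom this]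
  have "0 \<in> frechet_subdifferential (soup_objective Y lam L) (C, D)" .
  \<comment> \<open>Constant sequences show that Frechet subgradients belong to the limiting
    subdifferential.\<close>
  then have "0 \<in> subdifferential (soup_objective Y lam L) (C, D)"
    unfolding subdifferential_def
    by (intro CollectI exI[of _ "\<lambda>_. (C, D)"] exI[of _ "\<lambda>_. 0"]) auto
  then show ?thesis
    by (simp add: critical_point_def edom_def dom)
qed

subsection \<open>The iteration\<close>

text \<open>Telescoping in the order of the index type. Intersecting with an arbitrary set A permits
  induction by adding a maximal element.\<close>

lemma sum_lessThan_telescope:
  fixes \<Phi> :: "'a::{finite,linorder} set \<Rightarrow> 'b::ab_group_add"
  shows "(\<Sum>j\<in>UNIV. \<Phi> {..<j} - \<Phi> {..j}) = \<Phi> {} - \<Phi> UNIV"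
proof -
  have "(\<Sum>j\<in>A. \<Phi> (A \<inter> {..<j}) - \<Phi> (A \<inter> {..j})) = \<Phi> {} - \<Phi> A" for A :: "'a set"
    using finite[of A]
  proof (induction A rule: finite_linorder_max_induct)
    case empty
    show ?case by simp
  next
    case (insert b A)
    have "b \<notin> A" using insert by auto
    moreover have "insert b A \<inter> {..<j} = A \<inter> {..<j}" "insert b A \<inter> {..j} = A \<inter> {..j}"
      if "j \<in> A" for j
      using insert(2) that by auto
    moreover have "insert b A \<inter> {..<b} = A" "insert b A \<inter> {..b} = insert b A"
      using insert(2) by auto
    ultimately show ?case using insert by simp
  qed
  from this[of UNIV] show ?thesis by simp
qed

text \<open>Otherwise some subsequence has increments of norm at least e > 0. By compactness a
  further one converges, and \<open>step\<close> gives its shift the same limit.\<close>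

lemma tendsto_diff_Suc_of_subsequences:
  fixes X :: "nat \<Rightarrow> 'a::euclidean_space"
  assumes bdd: "bounded (range X)"
    and step: "\<And>r x. strict_mono r \<Longrightarrow> (\<lambda>k. X (r k)) \<longlonglongrightarrow> x \<Longrightarrow> (\<lambda>k. X (Suc (r k))) \<longlonglongrightarrow> x"
  shows "(\<lambda>t. X (Suc t) - X t) \<longlonglongrightarrow> 0"
proof (rule ccontr)
  assume "\<not> ?thesis"
  then obtain e where e: "0 < e" and "\<not> (\<forall>\<^sub>F t in sequentially. dist (X (Suc t) - X t) 0 < e)"
    by (auto simp: tendsto_iff)
  then have "\<exists>\<^sub>F t in sequentially. e \<le> norm (X (Suc t) - X t)"
    by (simp add: not_eventually not_less)
  then have "infinite {t. e \<le> norm (X (Suc t) - X t)}"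
    by (simp add: frequently_cofinite flip: cofinite_eq_sequentially)
  then obtain r :: "nat \<Rightarrow> nat" where r: "strict_mono r" "\<And>k. e \<le> norm (X (Suc (r k)) - X (r k))"
    by (metis (mono_tags, lifting) infinite_enumerate mem_Collect_eq)
  have "bounded (range (X \<circ> r))"
    using bdd by (rule bounded_subset) auto
  then obtain x s where s: "strict_mono s" "((X \<circ> r) \<circ> s) \<longlonglongrightarrow> x"
    using bounded_imp_convergent_subsequence by blast
  have "strict_mono (r \<circ> s)" using r(1) s(1) by (rule strict_mono_o)
  moreover have X: "(\<lambda>k. X ((r \<circ> s) k)) \<longlonglongrightarrow> x" using s(2) by (simp add: o_def)
  ultimately have "(\<lambda>k. X (Suc ((r \<circ> s) k))) \<longlonglongrightarrow> x" by (rule step)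
  then have "(\<lambda>k. norm (X (Suc ((r \<circ> s) k)) - X ((r \<circ> s) k))) \<longlonglongrightarrow> norm (x - x)"
    by (intro tendsto_norm tendsto_diff X)
  then have "e \<le> norm (x - x)"
    by (rule tendsto_lowerbound) (use r(2) in auto)
  with e show False by simp
qed

section \<open>Partially updated matrices and continuity of the update maps\<close>

definition mix_on :: "'J set \<Rightarrow> real ^ 'J ^ 'm \<Rightarrow> real ^ 'J ^ 'm \<Rightarrow> real ^ 'J ^ 'm" where
  "mix_on S A A' = (\<chi> i k. if k \<in> S then A $ i $ k else A' $ i $ k)"

lemma mix_columns_eq: "mix_columns j A A' = mix_on {..<j} A A'"
  by (simp add: mix_columns_def mix_on_def)

lemma column_mix_on: "column k (mix_on S A A') = (if k \<in> S then column k A else column k A')"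
  by (simp add: mix_on_def column_def vec_eq_iff)

lemma mix_on_nth: "mix_on S A A' $ i $ k = (if k \<in> S then A $ i $ k else A' $ i $ k)"
  by (simp add: mix_on_def)

lemma mix_on_empty [simp]: "mix_on {} A A' = A'"
  and mix_on_UNIV [simp]: "mix_on UNIV A A' = A"
  by (simp_all add: mix_on_def vec_eq_iff)

lemma tendsto_matrix_columnI:
  fixes f :: "'b \<Rightarrow> real ^ 'k ^ 'm"
  assumes "\<And>j. ((\<lambda>x. column j (f x)) \<longlongrightarrow> column j A) F"
  shows "(f \<longlongrightarrow> A) F"
proof (intro vec_tendstoI)
  fix i j
  show "((\<lambda>x. f x $ i $ j) \<longlongrightarrow> A $ i $ j) F"
    using tendsto_vec_nth[OF assms[of j], of i] by (simp add: column_nth)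
qed

lemma tendsto_column:
  fixes f :: "'b \<Rightarrow> real ^ 'k ^ 'm"
  shows "(f \<longlongrightarrow> A) F \<Longrightarrow> ((\<lambda>x. column j (f x)) \<longlongrightarrow> column j A) F"
  unfolding column_def by (intro tendsto_intros)

lemma tendsto_sparse_code_arg:
  assumes "(f \<longlongrightarrow> C) F" "(g \<longlongrightarrow> D) F"
  shows "((\<lambda>x. sparse_code_arg Y (f x) (g x) j) \<longlongrightarrow> sparse_code_arg Y C D j) F"
  unfolding sparse_code_arg_def matrix_vector_mult_def matrix_matrix_mult_def transpose_def column_def
  by (simp, intro tendsto_intros assms)

lemma tendsto_atom_arg:
  assumes "(f \<longlongrightarrow> C) F" "(g \<longlongrightarrow> D) F" "(h \<longlongrightarrow> c) F"
  shows "((\<lambda>x. atom_arg Y (f x) (g x) j (h x)) \<longlongrightarrow> atom_arg Y C D j c) F"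
  unfolding atom_arg_def matrix_vector_mult_def matrix_matrix_mult_def transpose_def column_def
  by (simp, intro tendsto_intros assms)

text \<open>The entrywise bound sums to c . b \<ge> c . c > 0.\<close>

lemma inner_clipped_threshold_pos:
  assumes "0 < lam" "lam < L" "clipped_threshold lam L b \<noteq> 0"
  shows "0 < clipped_threshold lam L b \<bullet> b"
proof -
  let ?c = "clipped_threshold lam L b"
  have "0 < ?c \<bullet> ?c" using assms(3) by simp
  also have "?c \<bullet> ?c \<le> ?c \<bullet> b"
    unfolding inner_vec_def using clip_thr_mult_ge[OF assms(1,2)]
    by (intro sum_mono) (simp add: clipped_threshold_nth power2_eq_square)
  finally show ?thesis .
qed

section \<open>Invariants of a run of the algorithm\<close>

locale soup_dil =
  fixes Y :: "real ^ 'N ^ 'n::{finite,linorder}"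
    and lam L :: real
    and Cs :: "nat \<Rightarrow> real ^ 'J::{finite,linorder} ^ 'N"
    and Ds :: "nat \<Rightarrow> real ^ 'J::{finite,linorder} ^ 'n::{finite,linorder}"
  assumes lam_pos: "0 < lam" and lam_less: "lam < L"
    and norm_atom_0: "norm (column j (Ds 0)) = 1"
    and abs_code_0: "\<bar>Cs 0 $ i $ j\<bar> \<le> L"
    and iterates: "soup_dil_iterates Y lam L (Cs 0) (Ds 0) Cs Ds"
begin

text \<open>The codes inside a sweep once the columns in S are updated: \<open>{..<j}\<close> is the
  state before step j and \<open>{..j}\<close> the state after it, with \<open>{}\<close> and
  \<open>UNIV\<close> the ends of the sweep.\<close>

definition mixC :: "nat \<Rightarrow> 'J set \<Rightarrow> real ^ 'J::{finite,linorder} ^ 'N" where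
  "mixC t S = mix_on S (Cs (Suc t)) (Cs t)"

definition mixD :: "nat \<Rightarrow> 'J set \<Rightarrow> real ^ 'J::{finite,linorder} ^ 'n::{finite,linorder}" where
  "mixD t S = mix_on S (Ds (Suc t)) (Ds t)"

definition barg :: "nat \<Rightarrow> 'J \<Rightarrow> real ^ 'N" where
  "barg t j = sparse_code_arg Y (mixC t {..<j}) (mixD t {..<j}) j"

definition harg :: "nat \<Rightarrow> 'J \<Rightarrow> real ^ 'n::{finite,linorder}" where
  "harg t j = atom_arg Y (mixC t {..<j}) (mixD t {..<j}) j (column j (Cs (Suc t)))"

lemma code_step: "column j (Cs (Suc t)) = clipped_threshold lam L (barg t j)"
  using iterates by (simp add: soup_dil_iterates_def Let_def barg_def mixC_def mixD_def mix_columns_eq)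

lemma code_step_nth: "Cs (Suc t) $ i $ j = clip_thr lam L (barg t j $ i)"
  using code_step[of j t] by (simp add: vec_eq_iff column_nth clipped_threshold_nth)

lemma atom_step: "column j (Ds (Suc t)) = atom_update (column j (Cs (Suc t))) (harg t j)"
  using iterates by (simp add: soup_dil_iterates_def Let_def harg_def mixC_def mixD_def mix_columns_eq)

lemma abs_code: "\<bar>Cs t $ i $ j\<bar> \<le> L"
proof (cases t)
  case 0
  then show ?thesis by (simp add: abs_code_0)
next
  case (Suc t')
  then show ?thesis
    using lam_pos lam_less by (simp only: code_step_nth) (rule abs_clip_thr_le, simp)
qed

lemma code_gap: "Cs (Suc t) $ i $ j \<noteq> 0 \<Longrightarrow> lam \<le> \<bar>Cs (Suc t) $ i $ j\<bar>"
  unfolding code_step_nth by (rule clip_thr_gap[OF lam_pos lam_less])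

text \<open>Proved jointly: normalising h gives a unit atom only if h is nonzero, and h is nonzero
  because its inner product with the old unit atom equals c . b > 0.\<close>

lemma norm_atom_and_harg:
  "norm (column j (Ds t)) = 1" "column j (Cs (Suc t)) \<noteq> 0 \<Longrightarrow> harg t j \<noteq> 0"
proof -
  have h: "harg t j \<noteq> 0" if d: "norm (column j (Ds t)) = 1" and c: "column j (Cs (Suc t)) \<noteq> 0" for t
  proof -
    have "column j (mixD t {..<j}) = column j (Ds t)"
      by (simp add: mixD_def column_mix_on)
    then have "harg t j \<bullet> column j (Ds t) = column j (Cs (Suc t)) \<bullet> barg t j"
      unfolding harg_def barg_def using d inner_atom_arg[of j "mixD t {..<j}"] by simp
    also have "\<dots> > 0"
      using c unfolding code_step by (intro inner_clipped_threshold_pos lam_pos lam_less)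
    finally show ?thesis by auto
  qed
  show n: "norm (column j (Ds t)) = 1"
  proof (induction t)
    case 0
    show ?case by (rule norm_atom_0)
  next
    case (Suc t)
    then show ?case using h by (auto simp: atom_step atom_update_def)
  qed
  show "column j (Cs (Suc t)) \<noteq> 0 \<Longrightarrow> harg t j \<noteq> 0"
    by (rule h[OF n])
qed

lemmas norm_atom = norm_atom_and_harg(1) and harg_nonzero = norm_atom_and_harg(2)

section \<open>Descent of the cost and vanishing of the gaps\<close>

definition cost_gap :: "nat \<Rightarrow> 'J \<Rightarrow> 'N \<Rightarrow> real" where
  "cost_gap t j i = entry_cost lam (barg t j $ i) (Cs t $ i $ j)
     - entry_cost lam (barg t j $ i) (Cs (Suc t) $ i $ j)"

text \<open>Half of the cost decrease caused by the atom update.\<close>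

definition atom_gap :: "nat \<Rightarrow> 'J \<Rightarrow> real" where
  "atom_gap t j = harg t j \<bullet> (column j (Ds (Suc t)) - column j (Ds t))"

lemma cost_gap_nonneg: "0 \<le> cost_gap t j i"
  unfolding cost_gap_def code_step_nth
  using entry_cost_clip_thr_le(1)[OF lam_pos lam_less abs_code] by simp

text \<open>For a zero code h is 0. Otherwise h . d' = |h|, the largest value that Cauchy-Schwarz
  allows for unit vectors.\<close>

lemma atom_gap_nonneg: "0 \<le> atom_gap t j"
proof (cases "column j (Cs (Suc t)) = 0")
  case True
  then show ?thesis by (simp add: atom_gap_def harg_def atom_arg_def)
next
  case False
  have "harg t j \<bullet> column j (Ds t) \<le> norm (harg t j) * norm (column j (Ds t))"
    by (rule norm_cauchy_schwarz)
  moreover have "harg t j \<bullet> column j (Ds (Suc t)) = norm (harg t j)"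
    using False harg_nonzero[OF False]
    by (simp add: atom_step atom_update_def power2_norm_eq_inner[symmetric] power2_eq_square)
  ultimately show ?thesis by (simp add: atom_gap_def inner_diff_right norm_atom)
qed

lemma soup_cost_step:
  "soup_cost Y lam (mixC t {..<j}) (mixD t {..<j}) - soup_cost Y lam (mixC t {..j}) (mixD t {..j})
   = (\<Sum>i\<in>UNIV. cost_gap t j i) + 2 * atom_gap t j"
proof -
  have agree: "column k (mixC t {..j}) = column k (mixC t {..<j})"
    "column k (mixD t {..j}) = column k (mixD t {..<j})" if "k \<noteq> j" for k
    using that by (auto simp: mixC_def mixD_def column_mix_on)
  \<comment> \<open>The step is split at the intermediate state in which code j is new and atom j is
    still old.\<close>
  have "soup_cost Y lam (mixC t {..<j}) (mixD t {..<j}) - soup_cost Y lam (mixC t {..j}) (mixD t {..<j})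
     = (\<Sum>i\<in>UNIV. cost_gap t j i)"
    using agree
    by (subst soup_cost_code_step[where j = j])
      (auto simp: cost_gap_def barg_def mixC_def mixD_def column_mix_on norm_atom mix_on_nth)
  moreover have "soup_cost Y lam (mixC t {..j}) (mixD t {..<j}) - soup_cost Y lam (mixC t {..j}) (mixD t {..j})
     = 2 * atom_gap t j"
    using agree
    by (subst soup_cost_atom_step[where j = j and C = "mixC t {..<j}"])
      (auto simp: atom_gap_def harg_def mixC_def mixD_def column_mix_on norm_atom)
  ultimately show ?thesis by simp
qed

lemma soup_cost_diff:
  "soup_cost Y lam (Cs t) (Ds t) - soup_cost Y lam (Cs (Suc t)) (Ds (Suc t))
   = (\<Sum>j\<in>UNIV. (\<Sum>i\<in>UNIV. cost_gap t j i) + 2 * atom_gap t j)"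
  using sum_lessThan_telescope[of "\<lambda>S. soup_cost Y lam (mixC t S) (mixD t S)"]
  unfolding soup_cost_step by (simp add: mixC_def mixD_def)

text \<open>Each gap lies between 0 and the decrease of the cost over a whole sweep; the cost is
  nonincreasing and bounded below, so these decreases tend to 0.\<close>

lemma gaps_tendsto_0:
  "(\<lambda>t. cost_gap t j i) \<longlonglongrightarrow> 0" "(\<lambda>t. atom_gap t j) \<longlonglongrightarrow> 0"
proof -
  define F where "F t = soup_cost Y lam (Cs t) (Ds t)" for t
  have total: "(\<Sum>i\<in>UNIV. cost_gap t j i) + 2 * atom_gap t j \<le> F t - F (Suc t)" for t j
    unfolding F_def soup_cost_diff
    by (rule member_le_sum) (auto intro!: add_nonneg_nonneg sum_nonneg cost_gap_nonneg atom_gap_nonneg)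
  have nn: "0 \<le> (\<Sum>i\<in>UNIV. cost_gap t j i)" for t
    by (intro sum_nonneg cost_gap_nonneg)
  have cost: "cost_gap t j i \<le> F t - F (Suc t)" for t
  proof -
    have "cost_gap t j i \<le> (\<Sum>i\<in>UNIV. cost_gap t j i)"
      by (rule member_le_sum) (auto intro: cost_gap_nonneg)
    with total[of t j] atom_gap_nonneg[of t j] show ?thesis by linarith
  qed
  have atom: "atom_gap t j \<le> F t - F (Suc t)" for t
    using total[of t j] nn[of t] atom_gap_nonneg[of t j] by linarith
  have "F (Suc t) \<le> F t" for t
    using cost[of t] cost_gap_nonneg[of t j i] by linarith
  then have "decseq F" by (simp add: decseq_Suc_iff)
  moreover have "0 \<le> F t" for t
    by (simp add: F_def soup_cost_nonneg)
  ultimately obtain l where "F \<longlonglongrightarrow> l"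
    using decseq_convergent[of F 0] by metis
  then have "(\<lambda>t. F t - F (Suc t)) \<longlonglongrightarrow> l - l"
    by (intro tendsto_diff LIMSEQ_Suc)
  then have lim: "(\<lambda>t. F t - F (Suc t)) \<longlonglongrightarrow> 0" by simp
  show "(\<lambda>t. cost_gap t j i) \<longlonglongrightarrow> 0"
    by (rule tendsto_sandwich[OF _ _ tendsto_const lim]) (simp_all add: cost_gap_nonneg cost)
  show "(\<lambda>t. atom_gap t j) \<longlonglongrightarrow> 0"
    by (rule tendsto_sandwich[OF _ _ tendsto_const lim]) (simp_all add: atom_gap_nonneg atom)
qed

text \<open>Along a convergent subsequence the step for column \<open>j\<close> is asymptotically stationary, as the
  descent vanishes in the limit and both block minimisers are unique there: the code because no
  entry of the limiting input has magnitude \<open>lam\<close>, the atom because its direction is nonzero.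
  For a zero code the atom already is the fixed fallback vector.\<close>

lemma subsequence_step:
  assumes r: "strict_mono r" and C: "(\<lambda>k. Cs (r k)) \<longlonglongrightarrow> C" and D: "(\<lambda>k. Ds (r k)) \<longlonglongrightarrow> D"
    and unit: "\<And>j. norm (column j D) = 1"
    and thr: "\<And>i. \<bar>sparse_code_arg Y C D j $ i\<bar> \<noteq> lam"
    and prevC: "\<And>k. k < j \<Longrightarrow> (\<lambda>m. column k (Cs (Suc (r m)))) \<longlonglongrightarrow> column k C"
    and prevD: "\<And>k. k < j \<Longrightarrow> (\<lambda>m. column k (Ds (Suc (r m)))) \<longlonglongrightarrow> column k D"
  shows "(\<lambda>m. column j (Cs (Suc (r m)))) \<longlonglongrightarrow> column j C"
    and "(\<lambda>m. column j (Ds (Suc (r m)))) \<longlonglongrightarrow> column j D"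
    and "C $ i $ j = clip_thr lam L (sparse_code_arg Y C D j $ i)"
    and "\<exists>s. (Y - D ** transpose C) *v column j C = s *\<^sub>R column j D"
proof -
  define b where "b = sparse_code_arg Y C D j"
  have mixC: "(\<lambda>m. mixC (r m) {..<j}) \<longlonglongrightarrow> C"
  proof (rule tendsto_matrix_columnI)
    fix k show "(\<lambda>m. column k (mixC (r m) {..<j})) \<longlonglongrightarrow> column k C"
      using prevC[of k] tendsto_column[OF C, of k] by (cases "k < j") (simp_all add: mixC_def column_mix_on)
  qed
  have mixD: "(\<lambda>m. mixD (r m) {..<j}) \<longlonglongrightarrow> D"
  proof (rule tendsto_matrix_columnI)
    fix k show "(\<lambda>m. column k (mixD (r m) {..<j})) \<longlonglongrightarrow> column k D"
      using prevD[of k] tendsto_column[OF D, of k] by (cases "k < j") (simp_all add: mixD_def column_mix_on)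
  qed
  have b: "(\<lambda>m. barg (r m) j $ i) \<longlonglongrightarrow> b $ i" for i
    unfolding barg_def b_def by (intro tendsto_vec_nth tendsto_sparse_code_arg mixC mixD)
  have Cij: "(\<lambda>m. Cs (r m) $ i $ j) \<longlonglongrightarrow> C $ i $ j" for i
    by (intro tendsto_vec_nth C)
  have Cnext: "(\<lambda>m. Cs (Suc (r m)) $ i $ j) \<longlonglongrightarrow> clip_thr lam L (b $ i)" for i
    unfolding code_step_nth
    by (rule tendsto_clip_thr[OF b _ lam_pos]) (use thr in \<open>simp add: b_def\<close>)
  \<comment> \<open>The gap is guaranteed only after a first update, since the entries of
    \<open>Cs 0\<close> are arbitrary in the box; the index must therefore be positive.\<close>
  have r_pos: "\<forall>\<^sub>F m in sequentially. 0 < r m"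
    by (rule eventually_compose_filterlim[OF eventually_gt_at_top filterlim_subseq[OF r]])
  have gap: "\<forall>\<^sub>F m in sequentially. Cs (r m) $ i $ j \<noteq> 0 \<longrightarrow> lam \<le> \<bar>Cs (r m) $ i $ j\<bar>" for i
    using r_pos by eventually_elim (metis code_gap gr0_implies_Suc)
  have fixpt: "C $ i $ j = clip_thr lam L (b $ i)" for i
  proof (rule ccontr)
    assume neq: "C $ i $ j \<noteq> clip_thr lam L (b $ i)"
    \<comment> \<open>The limit of the gaps is the excess of the limit entry over the minimum; it is
      0, whereas uniqueness of the minimiser would make it positive.\<close>
    have "(\<lambda>m. cost_gap (r m) j i) \<longlonglongrightarrow>
        entry_cost lam (b $ i) (C $ i $ j) - entry_cost lam (b $ i) (clip_thr lam L (b $ i))"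
      unfolding cost_gap_def
      by (intro tendsto_diff tendsto_entry_cost Cij Cnext b lam_pos gap always_eventually)
        (blast intro: code_gap)
    moreover have "(\<lambda>m. cost_gap (r m) j i) \<longlonglongrightarrow> 0"
      using LIMSEQ_subseq_LIMSEQ[OF gaps_tendsto_0(1) r] by (simp add: o_def)
    ultimately have "entry_cost lam (b $ i) (C $ i $ j) = entry_cost lam (b $ i) (clip_thr lam L (b $ i))"
      using LIMSEQ_unique by force
    moreover have "\<bar>C $ i $ j\<bar> \<le> L"
      by (rule tendsto_upperbound[OF tendsto_rabs[OF Cij]]) (simp_all add: abs_code)
    ultimately show False
      using entry_cost_clip_thr_le(2)[OF lam_pos lam_less _ _ neq] thr[of i] by (simp add: b_def)
  qed
  then show "C $ i $ j = clip_thr lam L (sparse_code_arg Y C D j $ i)"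
    by (simp add: b_def)
  show Cn: "(\<lambda>m. column j (Cs (Suc (r m)))) \<longlonglongrightarrow> column j C"
    by (intro vec_tendstoI) (use Cnext in \<open>simp add: column_nth fixpt\<close>)
  define h where "h = atom_arg Y C D j (column j C)"
  have h: "(\<lambda>m. harg (r m) j) \<longlonglongrightarrow> h"
    unfolding harg_def h_def by (intro tendsto_atom_arg mixC mixD Cn)
  have "(\<lambda>m. column j (Ds (Suc (r m)))) \<longlonglongrightarrow> column j D \<and>
    (\<exists>s. (Y - D ** transpose C) *v column j C = s *\<^sub>R column j D)"
  proof (cases "column j C = 0")
    case True
    \<comment> \<open>The gap turns a zero limit column into eventually zero columns; this is
      applied to the old and to the new codes.\<close>
    have ev: "\<forall>\<^sub>F m in sequentially. column j (f m) = 0"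
      if f: "\<And>i. (\<lambda>m. f m $ i $ j) \<longlonglongrightarrow> C $ i $ j"
        and g: "\<And>i. \<forall>\<^sub>F m in sequentially. f m $ i $ j \<noteq> 0 \<longrightarrow> lam \<le> \<bar>f m $ i $ j\<bar>"
      for f :: "nat \<Rightarrow> real ^ 'J::{finite,linorder} ^ 'N"
    proof -
      have "\<forall>\<^sub>F m in sequentially. \<forall>i. (f m $ i $ j \<noteq> 0) = (C $ i $ j \<noteq> 0)"
        by (intro eventually_all_finite eventually_neq_0_iff_limit[OF f lam_pos g])
      then show ?thesis
        by eventually_elim (use True in \<open>simp add: vec_eq_iff column_nth\<close>)
    qed
    have 0: "column j (Ds (Suc t)) = axis (Min UNIV) 1" if "column j (Cs (Suc t)) = 0" for t
      using that by (simp add: atom_step atom_update_def)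
    have "\<forall>\<^sub>F m in sequentially. column j (Cs (r m)) = 0" by (rule ev[OF Cij gap])
    with r_pos have "\<forall>\<^sub>F m in sequentially. column j (Ds (r m)) = axis (Min UNIV) 1"
      by eventually_elim (metis 0 gr0_implies_Suc)
    then have "(\<lambda>m. column j (Ds (r m))) \<longlonglongrightarrow> axis (Min UNIV) 1"
      by (rule tendsto_eventually)
    then have D0: "column j D = axis (Min UNIV) 1"
      using tendsto_column[OF D, of j] LIMSEQ_unique by blast
    have "\<forall>\<^sub>F m in sequentially. column j (Cs (Suc (r m))) = 0"
      by (rule ev) (use Cnext code_gap in \<open>simp_all add: fixpt\<close>)
    then have "\<forall>\<^sub>F m in sequentially. column j (Ds (Suc (r m))) = column j D"
      by eventually_elim (simp add: 0 D0)
    then show ?thesis using True by (auto intro: tendsto_eventually exI[of _ 0])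
  next
    case False
    have cC: "column j C = clipped_threshold lam L b"
      by (simp add: vec_eq_iff column_nth clipped_threshold_nth fixpt)
    have "h \<bullet> column j D = column j C \<bullet> b"
      unfolding h_def b_def by (rule inner_atom_arg[OF unit])
    also have "\<dots> > 0"
      using False unfolding cC by (intro inner_clipped_threshold_pos lam_pos lam_less)
    finally have h0: "h \<noteq> 0" by auto
    have "\<forall>\<^sub>F m in sequentially. column j (Cs (Suc (r m))) \<noteq> 0"
      by (rule tendsto_imp_eventually_ne[OF Cn False])
    then have ev: "\<forall>\<^sub>F m in sequentially. (1 / norm (harg (r m) j)) *\<^sub>R harg (r m) j = column j (Ds (Suc (r m)))"
      by eventually_elim (simp add: atom_step atom_update_def)
    have "(\<lambda>m. (1 / norm (harg (r m) j)) *\<^sub>R harg (r m) j) \<longlonglongrightarrow> (1 / norm h) *\<^sub>R h"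
      using h0 by (intro tendsto_intros h) simp
    then have lim: "(\<lambda>m. column j (Ds (Suc (r m)))) \<longlonglongrightarrow> (1 / norm h) *\<^sub>R h"
      using ev by (simp add: tendsto_cong)
    have "(\<lambda>m. atom_gap (r m) j) \<longlonglongrightarrow> h \<bullet> ((1 / norm h) *\<^sub>R h - column j D)"
      unfolding atom_gap_def by (intro tendsto_intros h lim tendsto_column D)
    moreover have "(\<lambda>m. atom_gap (r m) j) \<longlonglongrightarrow> 0"
      using LIMSEQ_subseq_LIMSEQ[OF gaps_tendsto_0(2) r] by (simp add: o_def)
    ultimately have "h \<bullet> ((1 / norm h) *\<^sub>R h - column j D) = 0"
      using LIMSEQ_unique by blast
    \<comment> \<open>The limit of the atom gaps is |h| - h . d. Its vanishing is the equality case
      of Cauchy-Schwarz, so h is a positive multiple of d.\<close>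
    then have "h \<bullet> column j D = norm h * norm (column j D)"
      using h0 by (simp add: inner_diff_right power2_norm_eq_inner[symmetric] power2_eq_square unit)
    then have hd: "h = norm h *\<^sub>R column j D"
      using norm_cauchy_schwarz_eq[of h "column j D"] by (simp add: unit)
    have "(1 / norm h) *\<^sub>R h = (1 / norm h) *\<^sub>R (norm h *\<^sub>R column j D)"
      using hd by simp
    also have "\<dots> = column j D" using h0 by simp
    finally have "(\<lambda>m. column j (Ds (Suc (r m)))) \<longlonglongrightarrow> column j D"
      using lim by simp
    \<comment> \<open>Old and new code share the limit c, so h = R c + |c|^2 d and R c is a multiple
      of d.\<close>
    moreover have "(Y - D ** transpose C) *v column j C = (norm h - column j C \<bullet> column j C) *\<^sub>R column j D"
      using hd unfolding h_def atom_arg_residual scaleR_left_diff_distrib by (simp add: algebra_simps)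
    ultimately show ?thesis by blast
  qed
  then show "(\<lambda>m. column j (Ds (Suc (r m)))) \<longlonglongrightarrow> column j D"
    and "\<exists>s. (Y - D ** transpose C) *v column j C = s *\<^sub>R column j D"
    by blast+
qed

section \<open>Whole sweeps along convergent subsequences, and boundedness\<close>

lemma norm_atom_limit:
  assumes "(\<lambda>k. Ds (r k)) \<longlonglongrightarrow> D"
  shows "norm (column j D) = 1"
  using LIMSEQ_unique[OF tendsto_norm[OF tendsto_column[OF assms, of j]]] by (simp add: norm_atom)

text \<open>Step j needs the new columns before j to converge already, so the columns are treated in
  update order. The limit then satisfies the stationarity conditions of all columns.\<close>

lemma subsequence_limit:
  assumes r: "strict_mono r" and C: "(\<lambda>k. Cs (r k)) \<longlonglongrightarrow> C" and D: "(\<lambda>k. Ds (r k)) \<longlonglongrightarrow> D"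
    and thr: "\<And>i j. \<bar>B_matrix Y C D $ i $ j\<bar> \<noteq> lam"
  shows "(\<lambda>k. Cs (Suc (r k))) \<longlonglongrightarrow> C" "(\<lambda>k. Ds (Suc (r k))) \<longlonglongrightarrow> D"
    and "critical_point (soup_objective Y lam L) (C, D)"
proof -
  have unit: "norm (column j D) = 1" for j
    by (rule norm_atom_limit[OF D])
  have thr': "\<bar>sparse_code_arg Y C D j $ i\<bar> \<noteq> lam" for i j
    using thr[of i j] by (simp add: B_matrix_nth unit)
  note step = subsequence_step[OF r C D unit thr']
  have cols: "(\<lambda>m. column j (Cs (Suc (r m)))) \<longlonglongrightarrow> column j C \<and>
        (\<lambda>m. column j (Ds (Suc (r m)))) \<longlonglongrightarrow> column j D" for j
  \<comment> \<open>Counting the earlier columns turns the update order into an induction over the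
    naturals.\<close>
  proof (induction "card {..<j}" arbitrary: j rule: less_induct)
    case less
    have "card {..<k} < card {..<j}" if "k < j" for k
      using that by (intro psubset_card_mono) auto
    with less step(1,2)[of j] show ?case by blast
  qed
  show "(\<lambda>k. Cs (Suc (r k))) \<longlonglongrightarrow> C" "(\<lambda>k. Ds (Suc (r k))) \<longlonglongrightarrow> D"
    using cols by (auto intro: tendsto_matrix_columnI)
  show "critical_point (soup_objective Y lam L) (C, D)"
    using cols step(3,4) by (intro critical_point_soup_objective lam_pos lam_less unit) blast+
qed

text \<open>Code entries are at most \<open>L\<close> and atom entries at most 1 in magnitude;
  summing over the entries bounds the Frobenius norms.\<close>

lemma bounded_iterates: "bounded (range (\<lambda>t. (Cs t, Ds t)))"
proof -
  have "norm (Cs t) \<le> (\<Sum>i\<in>(UNIV :: 'N set). \<Sum>j\<in>(UNIV :: 'J set). L)" for t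
    unfolding norm_vec_def
    by (intro order_trans[OF L2_set_le_sum] sum_mono order_trans[OF L2_set_le_sum])
      (simp_all add: abs_code)
  moreover have "\<bar>Ds t $ i $ j\<bar> \<le> 1" for t i j
    using component_le_norm_cart[of "column j (Ds t)" i] by (simp add: norm_atom column_nth)
  then have "norm (Ds t) \<le> (\<Sum>i\<in>(UNIV :: 'n set). \<Sum>j\<in>(UNIV :: 'J set). 1)" for t
    unfolding norm_vec_def
    by (intro order_trans[OF L2_set_le_sum] sum_mono order_trans[OF L2_set_le_sum])
      simp_all
  ultimately have "bounded (range Cs \<times> range Ds)"
    by (intro bounded_Times) (auto simp: bounded_iff)
  then show ?thesis by (rule bounded_subset) auto
qed

end

theorem theorem3:
  fixes Y :: "real ^ 'N ^ 'n::{finite,linorder}"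
    and lam L :: real
    and C0 :: "real ^ 'J::{finite,linorder} ^ 'N"
    and D0 :: "real ^ 'J::{finite,linorder} ^ 'n::{finite,linorder}"
    and Cs :: "nat \<Rightarrow> real ^ 'J::{finite,linorder} ^ 'N"
    and Ds :: "nat \<Rightarrow> real ^ 'J::{finite,linorder} ^ 'n::{finite,linorder}"
  assumes "0 < lam" and "lam < L"
    and "\<And>j. norm (column j D0) = 1"
    and "\<And>j. infnorm (column j C0) \<le> L"
    and "soup_dil_iterates Y lam L C0 D0 Cs Ds"
    and "\<And>C D i j. accumulation_point (\<lambda>t. (Cs t, Ds t)) (C, D) \<Longrightarrow>
           \<bar>B_matrix Y C D $ i $ j\<bar> \<noteq> lam"
  shows "(\<forall>C D. accumulation_point (\<lambda>t. (Cs t, Ds t)) (C, D) \<longrightarrow>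
             critical_point (soup_objective Y lam L) (C, D)) \<and>
         (\<lambda>t. norm (Ds (Suc t) - Ds t)) \<longlonglongrightarrow> 0 \<and>
         (\<lambda>t. norm (Cs (Suc t) - Cs t)) \<longlonglongrightarrow> 0"
proof -
  have C0: "Cs 0 = C0" and D0: "Ds 0 = D0"
    using assms(5) by (simp_all add: soup_dil_iterates_def)
  interpret soup_dil Y lam L Cs Ds
    using assms by unfold_locales (auto simp: C0 D0 infnorm_le_iff column_nth)
  have limit: "(\<lambda>k. (Cs (Suc (r k)), Ds (Suc (r k)))) \<longlonglongrightarrow> (C, D) \<and>
      critical_point (soup_objective Y lam L) (C, D)"
    if r: "strict_mono r" and lim: "(\<lambda>k. (Cs (r k), Ds (r k))) \<longlonglongrightarrow> (C, D)" for r C D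
  proof -
    have "accumulation_point (\<lambda>t. (Cs t, Ds t)) (C, D)"
      using r lim by (auto simp: accumulation_point_def o_def)
    note thr = assms(6)[OF this]
    have "(\<lambda>k. Cs (r k)) \<longlonglongrightarrow> C" "(\<lambda>k. Ds (r k)) \<longlonglongrightarrow> D"
      using tendsto_fst[OF lim] tendsto_snd[OF lim] by simp_all
    note sub = subsequence_limit[OF r this thr]
    show ?thesis using tendsto_Pair[OF sub(1,2)] sub(3) by blast
  qed
  \<comment> \<open>Codes and atoms are paired so that one convergent subsequence serves
    both.\<close>
  have diff: "(\<lambda>t. (Cs (Suc t), Ds (Suc t)) - (Cs t, Ds t)) \<longlonglongrightarrow> 0"
  proof (rule tendsto_diff_Suc_of_subsequences[OF bounded_iterates])
    fix r x
    assume "strict_mono r" "(\<lambda>k. (Cs (r k), Ds (r k))) \<longlonglongrightarrow> x"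
    then show "(\<lambda>k. (Cs (Suc (r k)), Ds (Suc (r k)))) \<longlonglongrightarrow> x"
      using limit by (cases x) blast
  qed
  show ?thesis
  proof (intro conjI allI impI)
    fix C D
    assume "accumulation_point (\<lambda>t. (Cs t, Ds t)) (C, D)"
    then show "critical_point (soup_objective Y lam L) (C, D)"
      using limit by (auto simp: accumulation_point_def o_def)
  next
    show "(\<lambda>t. norm (Ds (Suc t) - Ds t)) \<longlonglongrightarrow> 0"
      using tendsto_norm_zero[OF tendsto_snd[OF diff, simplified]] by simp
    show "(\<lambda>t. norm (Cs (Suc t) - Cs t)) \<longlonglongrightarrow> 0"
      using tendsto_norm_zero[OF tendsto_fst[OF diff, simplified]] by simp
  qed
qed

end
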